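(* Let $d,N\ge 1$ be integers, let $0<r\le 1$, and let $U:\mathbb{Z}^+\to\mathbb{R}^{d\times d}$. Let $Z:\mathbb{Z}^+\to\mathbb{R}^{d\times d}$ be the sequence satisfying $$Z(n+1)=\sum_{j=0}^{n}U(n-j)Z(j),\quad n\in\mathbb{Z}^+,\qquad Z(0)=I.$$ Suppose that $U\in\mathcal{WP}(r,N)$ with weight function $\phi\in\mathcal{W}(r)$, i.e. there exist matrices $A_0,\dots,A_{N-1}\in\mathbb{R}^{d\times d}$ such that $$\lim_{n\to\infty}\frac{1}{\phi(Nn)}U(Nn+i)=A_i,\qquad i\in\{0,1,\dots,N-1\},$$ and suppose that $$\max_{1\le p\le d}\left(\sum_{q=1}^{d}\sum_{i=0}^{N-1}\sum_{l=0}^{\infty}r^{-N(l+1)}|U(Nl+i)|_{p,q}\right)<1.$$ Then $Z\in\mathcal{WP}(r,N)$, and there exist matrices $\rho_0,\dots,\rho_{N-1}\in\mathbb{R}^{d\times d}$ such that $$\lim_{n\to\infty}\frac{1}{\phi(Nn)}Z(Nn+i)=\rho_i,\qquad i\in\{0,1,\dots,N-1\}.$$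
   Context: $\mathbb{Z}^+=\{n\in\mathbb{Z}:n\ge 0\}$; $I$ is the $d\times d$ identity matrix. For a matrix $A$, $|A|$ is the matrix of absolute values of its entries, and $|A|_{p,q}$ its $(p,q)$ entry. For $r>0$, a real sequence $\gamma=\{\gamma(n)\}_{n\ge 0}$ is in $\mathcal{W}(r)$ if $\gamma(n)>0$ for all $n\ge 0$, $$\lim_{n\to\infty}\frac{\gamma(n-1)}{\gamma(n)}=\frac1r,\qquad \sum_{i=0}^{\infty}\gamma(i)r^{-i}<\infty,\qquad \lim_{m\to\infty}\left(\limsup_{n\to\infty}\frac{1}{\gamma(n)}\sum_{i=m}^{n-m}\gamma(n-i)\gamma(i)\right)=0.$$ For integers $d,N\ge1$ and finite $r>0$, a sequence $U=\{U(n)\}_{n\ge0}$ in $\mathbb{R}^{d\times d}$ is in $\mathcal{WP}(r,N)$ if there exist $\phi\in\mathcal{W}(r)$ and $d\times d$ matrices $\{A_i\}_{i=0}^{N-1}$ such that $\lim_{n\to\infty}U(Nn+i)/\phi(Nn)=A_i$ for each $i\in\{0,\dots,N-1\}$; $\phi$ is then called a weight function for $U$. *)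

theory Defs
  imports "HOL-Analysis.Analysis"
begin

text \<open>
  The limit superior is taken in the extended reals, so that it always exists (it may be infinite
  for some \<open>m\<close>). The truncated subtractions only matter for finitely many \<open>n\<close> in each limit.
\<close>

definition weight_class :: "real \<Rightarrow> (nat \<Rightarrow> real) set" where
  "weight_class r = {\<gamma>. r > 0 \<and> (\<forall>n. \<gamma> n > 0) \<and>
     (\<lambda>n. \<gamma> (n - 1) / \<gamma> n) \<longlonglongrightarrow> 1 / r \<and>
     summable (\<lambda>i. \<gamma> i * r powi (- int i)) \<and>
     (\<lambda>m. limsup (\<lambda>n. ereal (1 / \<gamma> n * (\<Sum>i=m..n-m. \<gamma> (n - i) * \<gamma> i)))) \<longlonglongrightarrow> 0}"

definition weight_function ::
  "real \<Rightarrow> nat \<Rightarrow> (nat \<Rightarrow> real) \<Rightarrow> (nat \<Rightarrow> real ^ 'd ^ 'd) \<Rightarrow> bool" where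
  "weight_function r N \<phi> U \<longleftrightarrow> N \<ge> 1 \<and> \<phi> \<in> weight_class r \<and>
     (\<exists>A. \<forall>i<N. (\<lambda>n. (1 / \<phi> (N * n)) *\<^sub>R U (N * n + i)) \<longlonglongrightarrow> A i)"

definition periodic_weight_class :: "real \<Rightarrow> nat \<Rightarrow> (nat \<Rightarrow> real ^ 'd ^ 'd) set" where
  "periodic_weight_class r N = {U. \<exists>\<phi>. weight_function r N \<phi> U}"

end

theory Submission
  imports Defs
begin

text \<open>
  After division by the weight, \<open>w n = Z n / \<phi> n\<close> satisfies, entry by entry, a renewal equation whose
  kernel \<open>\<bar>U k\<bar> * r powi (- (k + 1))\<close> has row sums at most some \<open>\<rho> < 1\<close>: since \<open>r \<le> 1\<close>, the mass of each
  block \<open>N * l, \<dots>, N * l + N - 1\<close> is dominated by the one in the hypothesis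
  (\<open>partial_mass_le_block_mass\<close>). The convolution giving \<open>Z (n + 1)\<close> is cut into three parts
  by a cutoff \<open>m\<close> that is fixed while \<open>n\<close> tends to infinity.

  \<^item> Near part, \<open>U k\<close> with \<open>k < m\<close>: here \<open>\<phi> (n - k) / \<phi> (n + 1)\<close> tends to \<open>(1 / r) ^ (k + 1)\<close>, so the
    part acts on the values \<open>w (n - k)\<close> as a contraction with factor about \<open>\<rho>\<close>.
  \<^item> Middle part: bounded by a multiple of the sum of \<open>\<phi> (n - k) * \<phi> k\<close> over \<open>m \<le> k \<le> n - m\<close>, which
    the last condition on a weight makes a small multiple of \<open>\<phi> n\<close> once \<open>m\<close> is large.
  \<^item> Edge part, \<open>Z j\<close> with \<open>j < m\<close>: a fixed finite combination of the quotients \<open>U (n - j) / \<phi> (n + 1)\<close>,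
    which converge along every residue class modulo \<open>N\<close>.

  The cut is used twice. It first shows that \<open>w\<close> is bounded (\<open>x_bounded\<close>). It then shows that if the
  oscillation of \<open>w\<close> along residue classes is eventually at most \<open>L\<close>, then it is eventually at most
  \<open>\<rho> * L + \<epsilon>\<close> for every \<open>\<epsilon> > 0\<close> (\<open>osc_step\<close>). Iterating from the bound for \<open>w\<close> drives the
  oscillation to zero (\<open>solution_osc\<close>). So \<open>w\<close> is Cauchy, hence convergent, along every residue class.
\<close>

section \<open>Oscillation along residue classes\<close>

text \<open>
  This bounds the limit superior of \<open>\<bar>f n - f n'\<bar>\<close> over pairs of congruent arguments. A bound that
  holds eventually, rather than the limit superior itself, composes directly with sums, multiples
  and shifts.
\<close>

definition residue_osc_le :: "nat \<Rightarrow> (nat \<Rightarrow> real) \<Rightarrow> real \<Rightarrow> bool" where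
  "residue_osc_le N f L \<longleftrightarrow>
     (\<exists>n0. \<forall>n\<ge>n0. \<forall>n'\<ge>n0. n mod N = n' mod N \<longrightarrow> \<bar>f n - f n'\<bar> \<le> L)"

lemma residue_osc_le_add:
  assumes "residue_osc_le N f L" "residue_osc_le N g K"
  shows "residue_osc_le N (\<lambda>n. f n + g n) (L + K)"
proof -
  obtain a b where
    a: "\<And>n n'. n \<ge> a \<Longrightarrow> n' \<ge> a \<Longrightarrow> n mod N = n' mod N \<Longrightarrow> \<bar>f n - f n'\<bar> \<le> L" and
    b: "\<And>n n'. n \<ge> b \<Longrightarrow> n' \<ge> b \<Longrightarrow> n mod N = n' mod N \<Longrightarrow> \<bar>g n - g n'\<bar> \<le> K"
    using assms unfolding residue_osc_le_def by blast
  have "\<bar>(f n + g n) - (f n' + g n')\<bar> \<le> L + K"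
    if "n \<ge> max a b" "n' \<ge> max a b" "n mod N = n' mod N" for n n'
    using a[of n n'] b[of n n'] that by fastforce
  then show ?thesis unfolding residue_osc_le_def by blast
qed

lemma residue_osc_le_cmult:
  assumes "residue_osc_le N f L"
  shows "residue_osc_le N (\<lambda>n. c * f n) (\<bar>c\<bar> * L)"
proof -
  have "\<bar>c * f n - c * f n'\<bar> = \<bar>c\<bar> * \<bar>f n - f n'\<bar>" for n n'
    by (metis abs_mult right_diff_distrib)
  then show ?thesis
    using assms unfolding residue_osc_le_def by (metis abs_ge_zero mult_left_mono)
qed

lemma residue_osc_le_mono:
  assumes "residue_osc_le N f L" "L \<le> K"
  shows "residue_osc_le N f K"
  using assms unfolding residue_osc_le_def by fastforce

lemma residue_osc_le_sum:
  assumes "finite A" "\<And>a. a \<in> A \<Longrightarrow> residue_osc_le N (f a) (L a)"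
  shows "residue_osc_le N (\<lambda>n. \<Sum>a\<in>A. f a n) (\<Sum>a\<in>A. L a)"
  using assms
proof (induction A rule: finite_induct)
  case empty
  then show ?case by (simp add: residue_osc_le_def)
next
  case (insert a A)
  then show ?case by (simp add: residue_osc_le_add)
qed

text \<open>
  Subtracting \<open>k\<close> keeps large congruent arguments congruent; this is what lets the near part of a convolution inherit the oscillation of the solution.
\<close>

lemma residue_osc_le_shift:
  assumes "residue_osc_le N f L"
  shows "residue_osc_le N (\<lambda>n. f (n - k)) L"
proof -
  obtain a where
    a: "\<And>n n'. n \<ge> a \<Longrightarrow> n' \<ge> a \<Longrightarrow> n mod N = n' mod N \<Longrightarrow> \<bar>f n - f n'\<bar> \<le> L"
    using assms unfolding residue_osc_le_def by blast
  have "\<bar>f (n - k) - f (n' - k)\<bar> \<le> L"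
    if "n \<ge> a + k" "n' \<ge> a + k" "n mod N = n' mod N" for n n'
  proof -
    have "((n - k) + k) mod N = ((n' - k) + k) mod N" using that by simp
    then have "(n - k) mod N = (n' - k) mod N"
      unfolding nat_mod_eq_iff by (metis add.assoc add.commute add_left_cancel)
    then show ?thesis using a[of "n - k" "n' - k"] that by simp
  qed
  then show ?thesis unfolding residue_osc_le_def by blast
qed

lemma residue_osc_le_Suc_iff:
  "residue_osc_le N (\<lambda>n. f (Suc n)) L \<longleftrightarrow> residue_osc_le N f L"
proof
  assume "residue_osc_le N (\<lambda>n. f (Suc n)) L"
  then have "residue_osc_le N (\<lambda>n. f (Suc (n - 1))) L"
    by (rule residue_osc_le_shift)
  then obtain a where a: "\<And>n n'. n \<ge> a \<Longrightarrow> n' \<ge> a \<Longrightarrow> n mod N = n' mod N \<Longrightarrow>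
      \<bar>f (Suc (n - 1)) - f (Suc (n' - 1))\<bar> \<le> L"
    unfolding residue_osc_le_def by blast
  have "\<bar>f n - f n'\<bar> \<le> L" if "n \<ge> Suc a" "n' \<ge> Suc a" "n mod N = n' mod N" for n n'
    using a[of n n'] that by simp
  then show "residue_osc_le N f L" unfolding residue_osc_le_def by blast
next
  assume "residue_osc_le N f L"
  then show "residue_osc_le N (\<lambda>n. f (Suc n)) L"
    unfolding residue_osc_le_def by (metis le_SucI mod_Suc)
qed

lemma residue_osc_le_small:
  assumes "eventually (\<lambda>n. \<bar>f n\<bar> \<le> L) sequentially"
  shows "residue_osc_le N f (2 * L)"
proof -
  obtain a where a: "\<And>n. n \<ge> a \<Longrightarrow> \<bar>f n\<bar> \<le> L"
    using assms unfolding eventually_sequentially by blast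
  have "\<bar>f n - f n'\<bar> \<le> 2 * L" if "n \<ge> a" "n' \<ge> a" for n n'
    using a[OF that(1)] a[OF that(2)] by linarith
  then show ?thesis unfolding residue_osc_le_def by blast
qed

lemma residue_osc_le_null:
  assumes "f \<longlonglongrightarrow> 0" "\<epsilon> > 0"
  shows "residue_osc_le N f \<epsilon>"
proof -
  have "eventually (\<lambda>n. \<bar>f n\<bar> \<le> \<epsilon> / 2) sequentially"
    using tendstoD[OF assms(1), of "\<epsilon> / 2"] assms(2)
    by (auto elim: eventually_mono)
  from residue_osc_le_small[OF this] show ?thesis by simp
qed

lemma residue_osc_le_cong:
  assumes "eventually (\<lambda>n. f n = g n) sequentially"
  shows "residue_osc_le N f L \<longleftrightarrow> residue_osc_le N g L"
proof -
  have *: "residue_osc_le N g L"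
    if ev: "eventually (\<lambda>n. f n = g n) sequentially" and f: "residue_osc_le N f L" for f g
  proof -
    have "eventually (\<lambda>n. \<bar>g n - f n\<bar> \<le> 0) sequentially"
      using ev by (auto elim: eventually_mono)
    from residue_osc_le_add[OF f residue_osc_le_small[OF this]] show ?thesis by simp
  qed
  have "eventually (\<lambda>n. g n = f n) sequentially"
    using assms by (auto elim: eventually_mono)
  with assms * show ?thesis by blast
qed

text \<open>
  Every late argument is congruent to one in a fixed finite window, where \<open>f\<close> takes finitely many
  values.
\<close>

lemma residue_osc_le_bounded:
  assumes "residue_osc_le N f L" "N \<ge> 1"
  obtains B where "B \<ge> 0" "\<And>n. \<bar>f n\<bar> \<le> B"
proof -
  obtain a where
    a: "\<And>n n'. n \<ge> a \<Longrightarrow> n' \<ge> a \<Longrightarrow> n mod N = n' mod N \<Longrightarrow> \<bar>f n - f n'\<bar> \<le> L"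
    using assms(1) unfolding residue_osc_le_def by blast
  define S where "S = (\<Sum>j\<le>N * a + N. \<bar>f j\<bar>)"
  have S: "\<bar>f j\<bar> \<le> S" if "j \<le> N * a + N" for j
    unfolding S_def using that by (intro member_le_sum) auto
  have "\<bar>f n\<bar> \<le> \<bar>L\<bar> + S" for n
  proof (cases "n \<ge> a")
    case True
    \<comment> \<open>The representative of the class of \<open>n\<close> in the window beginning at \<open>N * a\<close>.\<close>
    define n' where "n' = N * a + n mod N"
    have "n' \<ge> a" using assms(2) unfolding n'_def
      by (metis mult.commute mult_le_mono2 mult.right_neutral trans_le_add1)
    moreover have "n mod N = n' mod N" unfolding n'_def by simp
    moreover have "n' \<le> N * a + N" unfolding n'_def using assms(2)
      by (simp add: less_imp_le)
    ultimately show ?thesis using a[OF True, of n'] S[of n'] by linarith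
  next
    case False
    then have "n \<le> N * a + N" using assms(2)
      by (metis add_leD1 le_add1 le_trans mult_le_mono1 nat_le_linear nat_mult_1)
    then show ?thesis using S[of n] by linarith
  qed
  moreover have "\<bar>L\<bar> + S \<ge> 0" unfolding S_def by (intro add_nonneg_nonneg sum_nonneg) auto
  ultimately show ?thesis using that by blast
qed

text \<open>
  Vanishing oscillation is the Cauchy criterion along all residue classes simultaneously.
\<close>

lemma residue_osc_le_iff_convergent:
  assumes "N \<ge> 1"
  shows "(\<forall>\<epsilon>>0. residue_osc_le N f \<epsilon>) \<longleftrightarrow> (\<forall>i<N. convergent (\<lambda>n. f (N * n + i)))"
proof (intro iffI allI impI)
  fix i assume small: "\<forall>\<epsilon>>0. residue_osc_le N f \<epsilon>" and i: "i < N"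
  have "Cauchy (\<lambda>n. f (N * n + i))"
  proof (rule metric_CauchyI)
    fix \<epsilon> :: real assume "\<epsilon> > 0"
    then have "residue_osc_le N f (\<epsilon> / 2)" using small by simp
    then obtain a where
      a: "\<And>n n'. n \<ge> a \<Longrightarrow> n' \<ge> a \<Longrightarrow> n mod N = n' mod N \<Longrightarrow> \<bar>f n - f n'\<bar> \<le> \<epsilon> / 2"
      unfolding residue_osc_le_def by blast
    have ge: "N * n + i \<ge> a" if "n \<ge> a" for n
      using that assms by (metis mult_le_mono nat_mult_1 trans_le_add1)
    have "dist (f (N * m + i)) (f (N * n + i)) < \<epsilon>" if "m \<ge> a" "n \<ge> a" for m n
      using a[OF ge ge, OF that] \<open>\<epsilon> > 0\<close> by (simp add: dist_real_def)
    then show "\<exists>M. \<forall>m\<ge>M. \<forall>n\<ge>M. dist (f (N * m + i)) (f (N * n + i)) < \<epsilon>" by blast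
  qed
  then show "convergent (\<lambda>n. f (N * n + i))" by (rule Cauchy_convergent)
next
  fix \<epsilon> :: real
  assume conv: "\<forall>i<N. convergent (\<lambda>n. f (N * n + i))" and "\<epsilon> > 0"
  have "\<exists>M. \<forall>m\<ge>M. \<forall>n\<ge>M. dist (f (N * m + i)) (f (N * n + i)) < \<epsilon>" if "i < N" for i
    using conv that convergent_Cauchy metric_CauchyD \<open>\<epsilon> > 0\<close> by blast
  then obtain M where
    M: "\<And>i m n. i < N \<Longrightarrow> m \<ge> M i \<Longrightarrow> n \<ge> M i \<Longrightarrow> \<bar>f (N * m + i) - f (N * n + i)\<bar> < \<epsilon>"
    unfolding dist_real_def by metis
  define K where "K = (\<Sum>i<N. M i)"
  have K: "M i \<le> K" if "i < N" for i
    unfolding K_def using that by (intro member_le_sum) auto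
  have "\<bar>f n - f n'\<bar> \<le> \<epsilon>" if n: "n \<ge> N * K" and n': "n' \<ge> N * K" and eq: "n mod N = n' mod N" for n n'
  proof -
    have N: "0 < N" using assms by simp
    have i: "n mod N < N" using N by simp
    have "n div N \<ge> K" "n' div N \<ge> K"
      using n n' N by (simp_all add: less_eq_div_iff_mult_less_eq mult.commute)
    then have "\<bar>f (N * (n div N) + n mod N) - f (N * (n' div N) + n mod N)\<bar> < \<epsilon>"
      using K[OF i] by (intro M i) auto
    moreover have "N * (n div N) + n mod N = n" by simp
    moreover have "N * (n' div N) + n mod N = n'" using eq by simp
    ultimately show ?thesis by simp
  qed
  then show "residue_osc_le N f \<epsilon>" unfolding residue_osc_le_def by blast
qed

section \<open>The renewal equation with a subexponential weight\<close>

text \<open>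
  The near, middle and edge parts. The edge part is indexed from the far end because there the
  second factor of a convolution has the small index.
\<close>

lemma sum_split_ends:
  fixes g :: "nat \<Rightarrow> 'a::comm_monoid_add"
  assumes "2 * m \<le> n"
  shows "(\<Sum>k\<le>n. g k) = (\<Sum>k<m. g k) + (\<Sum>k=m..n-m. g k) + (\<Sum>j<m. g (n - j))"
proof -
  have "{..n} = ({..<m} \<union> {m..n-m}) \<union> {n-m<..n}" using assms by auto
  then have "(\<Sum>k\<le>n. g k) = sum g ({..<m} \<union> {m..n-m}) + sum g {n-m<..n}"
    using assms by (simp only:, intro sum.union_disjoint) auto
  also have "sum g ({..<m} \<union> {m..n-m}) = (\<Sum>k<m. g k) + (\<Sum>k=m..n-m. g k)"
    by (intro sum.union_disjoint) auto
  also have "sum g {n-m<..n} = (\<Sum>j<m. g (n - j))"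
    by (rule sum.reindex_bij_witness[of _ "\<lambda>j. n - j" "\<lambda>k. n - k"]) (use assms in auto)
  finally show ?thesis .
qed

lemma ratio_tendsto_power:
  fixes \<phi> :: "nat \<Rightarrow> real"
  assumes pos: "\<And>n. \<phi> n > 0" and ratio: "(\<lambda>n. \<phi> n / \<phi> (Suc n)) \<longlonglongrightarrow> c"
  shows "(\<lambda>n. \<phi> n / \<phi> (n + k)) \<longlonglongrightarrow> c ^ k"
proof (induction k)
  case 0
  then show ?case using pos by (simp add: less_imp_neq[symmetric])
next
  case (Suc k)
  have "(\<lambda>n. \<phi> (n + k) / \<phi> (Suc (n + k))) \<longlonglongrightarrow> c"
    using LIMSEQ_ignore_initial_segment[OF ratio, of k] by simp
  from tendsto_mult[OF Suc.IH this]
  show ?case using pos by (simp add: less_imp_neq[symmetric] mult.commute)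
qed

text \<open>
  The function \<open>x\<close> stands for a single column of the matrix solution: the recursion acts on each column
  separately, and the hypothesis on row sums is exactly what contracts the maximum norm of a column.
  The power \<open>Suc k\<close> in the bound on the mass reflects that \<open>u p q k\<close> carries \<open>x q (n - k)\<close> to time
  \<open>n + 1\<close>.
\<close>

locale weighted_renewal =
  fixes \<phi> :: "nat \<Rightarrow> real" and r \<rho> :: real and N :: nat
    and u :: "'d::finite \<Rightarrow> 'd \<Rightarrow> nat \<Rightarrow> real" and x :: "'d \<Rightarrow> nat \<Rightarrow> real"
  assumes N: "N \<ge> 1"
    and pos: "\<And>n. \<phi> n > 0"
    and r: "r > 0"
    and ratio: "(\<lambda>n. \<phi> n / \<phi> (Suc n)) \<longlonglongrightarrow> 1 / r"
    and middle: "\<And>\<epsilon>. \<epsilon> > 0 \<Longrightarrow>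
          \<exists>M. \<forall>m\<ge>M. \<forall>\<^sub>F n in sequentially. (\<Sum>i=m..n-m. \<phi> (n - i) * \<phi> i) \<le> \<epsilon> * \<phi> n"
    and u_osc: "\<And>p q \<epsilon>. \<epsilon> > 0 \<Longrightarrow> residue_osc_le N (\<lambda>n. u p q n / \<phi> n) \<epsilon>"
    and mass: "\<And>p m. (\<Sum>k<m. \<Sum>q\<in>UNIV. \<bar>u p q k\<bar> * (1 / r) ^ Suc k) \<le> \<rho>"
    and \<rho>: "\<rho> < 1"
    and rec: "\<And>p n. x p (Suc n) = (\<Sum>k\<le>n. \<Sum>q\<in>UNIV. u p q k * x q (n - k))"
begin

lemma rho_nonneg: "\<rho> \<ge> 0"
  using mass[where m = 0] by simp

lemma shifted_ratio: "(\<lambda>n. \<phi> (n - k) / \<phi> (Suc n)) \<longlonglongrightarrow> (1 / r) ^ Suc k"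
proof (rule LIMSEQ_offset)
  show "(\<lambda>n. \<phi> (n + k - k) / \<phi> (Suc (n + k))) \<longlonglongrightarrow> (1 / r) ^ Suc k"
    using ratio_tendsto_power[OF pos ratio, of "Suc k"] by simp
qed

lemma u_bounded:
  obtains C where "C > 0" "\<And>p q n. \<bar>u p q n\<bar> \<le> C * \<phi> n"
proof -
  have "\<exists>B\<ge>0. \<forall>n. \<bar>u p q n / \<phi> n\<bar> \<le> B" for p q
    using residue_osc_le_bounded[OF u_osc[of 1 p q] N] by (metis zero_less_one)
  then obtain B where B0: "\<And>p q. B p q \<ge> 0" and B: "\<And>p q n. \<bar>u p q n / \<phi> n\<bar> \<le> B p q"
    by metis
  define C where "C = 1 + (\<Sum>p\<in>UNIV. \<Sum>q\<in>UNIV. B p q)"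
  have "B p q \<le> C" for p q
  proof -
    have "B p q \<le> (\<Sum>q\<in>UNIV. B p q)"
      using B0 by (intro member_le_sum) auto
    also have "\<dots> \<le> (\<Sum>p\<in>UNIV. \<Sum>q\<in>UNIV. B p q)"
      using B0 by (intro member_le_sum[of p UNIV "\<lambda>p. \<Sum>q\<in>UNIV. B p q"] sum_nonneg) auto
    finally show ?thesis unfolding C_def by simp
  qed
  then have "\<bar>u p q n\<bar> \<le> C * \<phi> n" for p q n
    using B[of p q n] pos[of n] order_trans[OF B[of p q n], of C]
    by (simp add: abs_divide abs_of_pos pos_divide_le_eq)
  moreover have "C > 0" unfolding C_def using B0
    by (intro add_pos_nonneg sum_nonneg) auto
  ultimately show ?thesis using that by blast
qed

text \<open>
  As \<open>u = O(\<phi>)\<close>, the middle part is governed by the middle of the self-convolution of \<open>\<phi>\<close>; replacing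
  \<open>\<phi> n\<close> by \<open>\<phi> (Suc n)\<close> costs a factor bounded by \<open>1 / r + 1\<close>.
\<close>

lemma middle_small:
  assumes "\<epsilon> > 0"
  shows "\<exists>m. \<forall>\<^sub>F n in sequentially. \<forall>p.
           (\<Sum>k=m..n-m. \<Sum>q\<in>UNIV. \<bar>u p q k\<bar> * \<phi> (n - k)) \<le> \<epsilon> * \<phi> (Suc n)"
proof -
  obtain C where C: "C > 0" "\<And>p q n. \<bar>u p q n\<bar> \<le> C * \<phi> n" using u_bounded by blast
  define D where "D = real CARD('d) * C"
  have D: "D > 0" unfolding D_def using C(1) by simp
  define \<delta> where "\<delta> = \<epsilon> / (D * (1 / r + 1))"
  have \<delta>: "\<delta> > 0" unfolding \<delta>_def using assms D r by (simp add: add_pos_pos)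
  obtain m where m: "\<forall>\<^sub>F n in sequentially. (\<Sum>i=m..n-m. \<phi> (n - i) * \<phi> i) \<le> \<delta> * \<phi> n"
    using middle[OF \<delta>] by blast
  have "\<forall>\<^sub>F n in sequentially. \<phi> n / \<phi> (Suc n) < 1 / r + 1"
    by (rule order_tendstoD(2)[OF ratio]) simp
  with m have "\<forall>\<^sub>F n in sequentially. \<forall>p.
           (\<Sum>k=m..n-m. \<Sum>q\<in>UNIV. \<bar>u p q k\<bar> * \<phi> (n - k)) \<le> \<epsilon> * \<phi> (Suc n)"
  proof eventually_elim
    case (elim n)
    show ?case
    proof
      fix p
      have "(\<Sum>k=m..n-m. \<Sum>q\<in>UNIV. \<bar>u p q k\<bar> * \<phi> (n - k))
              \<le> (\<Sum>k=m..n-m. \<Sum>q\<in>(UNIV :: 'd set). (C * \<phi> k) * \<phi> (n - k))"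
        using C(2) pos by (intro sum_mono mult_right_mono) (auto intro: less_imp_le)
      also have "\<dots> = D * (\<Sum>k=m..n-m. \<phi> (n - k) * \<phi> k)"
        by (simp add: D_def sum_distrib_left mult_ac)
      also have "\<dots> \<le> D * (\<delta> * \<phi> n)"
        using elim(1) D by (intro mult_left_mono) auto
      also have "\<dots> \<le> D * (\<delta> * ((1 / r + 1) * \<phi> (Suc n)))"
        using elim(2) D \<delta> pos[of "Suc n"]
        by (intro mult_left_mono) (auto simp: pos_divide_less_eq)
      also have "\<dots> = \<epsilon> * \<phi> (Suc n)"
      proof -
        have "D * (1 / r + 1) \<noteq> 0" using D r by (simp add: add_pos_pos less_imp_neq[symmetric])
        then have "(D * (1 / r + 1)) * \<delta> = \<epsilon>" unfolding \<delta>_def by simp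
        then show ?thesis by (metis mult.assoc mult.commute)
      qed
      finally show "(\<Sum>k=m..n-m. \<Sum>q\<in>UNIV. \<bar>u p q k\<bar> * \<phi> (n - k)) \<le> \<epsilon> * \<phi> (Suc n)" .
    qed
  qed
  then show ?thesis by blast
qed

text \<open>
  With \<open>m\<close> fixed, the finitely many weight ratios tend to the powers of \<open>1 / r\<close> that appear in the
  bound on the mass.
\<close>

lemma near_mass:
  assumes "\<epsilon> > 0"
  shows "\<forall>\<^sub>F n in sequentially. \<forall>p.
           (\<Sum>k<m. \<Sum>q\<in>UNIV. \<bar>u p q k\<bar> * \<phi> (n - k)) \<le> (\<rho> + \<epsilon>) * \<phi> (Suc n)"
proof (rule eventually_all_finite)
  fix p
  have "(\<lambda>n. \<Sum>k<m. \<Sum>q\<in>UNIV. \<bar>u p q k\<bar> * (\<phi> (n - k) / \<phi> (Suc n)))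
          \<longlonglongrightarrow> (\<Sum>k<m. \<Sum>q\<in>UNIV. \<bar>u p q k\<bar> * (1 / r) ^ Suc k)"
    by (intro tendsto_intros shifted_ratio)
  moreover have "(\<Sum>k<m. \<Sum>q\<in>UNIV. \<bar>u p q k\<bar> * (1 / r) ^ Suc k) < \<rho> + \<epsilon>"
    using mass[of p m] assms by linarith
  ultimately have "\<forall>\<^sub>F n in sequentially.
      (\<Sum>k<m. \<Sum>q\<in>UNIV. \<bar>u p q k\<bar> * (\<phi> (n - k) / \<phi> (Suc n))) < \<rho> + \<epsilon>"
    by (rule order_tendstoD(2))
  then show "\<forall>\<^sub>F n in sequentially.
      (\<Sum>k<m. \<Sum>q\<in>UNIV. \<bar>u p q k\<bar> * \<phi> (n - k)) \<le> (\<rho> + \<epsilon>) * \<phi> (Suc n)"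
  proof eventually_elim
    case (elim n)
    have "(\<Sum>k<m. \<Sum>q\<in>UNIV. \<bar>u p q k\<bar> * (\<phi> (n - k) / \<phi> (Suc n)))
        = (\<Sum>k<m. \<Sum>q\<in>UNIV. \<bar>u p q k\<bar> * \<phi> (n - k)) / \<phi> (Suc n)"
      by (simp add: sum_divide_distrib)
    then show ?case using elim pos[of "Suc n"] by (simp add: pos_divide_less_eq)
  qed
qed

lemma edge_bounded:
  obtains K where "K \<ge> 0"
    "\<forall>\<^sub>F n in sequentially. \<forall>p. (\<Sum>j<m. \<Sum>q\<in>UNIV. \<bar>u p q (n - j) * x q j\<bar>) \<le> K * \<phi> (Suc n)"
proof -
  obtain C where C: "C > 0" "\<And>p q n. \<bar>u p q n\<bar> \<le> C * \<phi> n" using u_bounded by blast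
  define l where "l = (\<Sum>j<m. \<Sum>q\<in>UNIV. C * \<bar>x q j\<bar> * (1 / r) ^ Suc j)"
  have "(\<lambda>n. \<Sum>j<m. \<Sum>q\<in>UNIV. C * \<bar>x q j\<bar> * (\<phi> (n - j) / \<phi> (Suc n))) \<longlonglongrightarrow> l"
    unfolding l_def by (intro tendsto_intros shifted_ratio)
  then have "\<forall>\<^sub>F n in sequentially.
      (\<Sum>j<m. \<Sum>q\<in>UNIV. C * \<bar>x q j\<bar> * (\<phi> (n - j) / \<phi> (Suc n))) < l + 1"
    by (rule order_tendstoD(2)) simp
  then have "\<forall>\<^sub>F n in sequentially. \<forall>p.
      (\<Sum>j<m. \<Sum>q\<in>UNIV. \<bar>u p q (n - j) * x q j\<bar>) \<le> (l + 1) * \<phi> (Suc n)"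
  proof eventually_elim
    case (elim n)
    show ?case
    proof
      fix p
      have "(\<Sum>j<m. \<Sum>q\<in>UNIV. \<bar>u p q (n - j) * x q j\<bar>)
          \<le> (\<Sum>j<m. \<Sum>q\<in>UNIV. (C * \<phi> (n - j)) * \<bar>x q j\<bar>)"
        unfolding abs_mult using C(2) by (intro sum_mono mult_right_mono) auto
      also have "\<dots> = (\<Sum>j<m. \<Sum>q\<in>UNIV. C * \<bar>x q j\<bar> * (\<phi> (n - j) / \<phi> (Suc n))) * \<phi> (Suc n)"
        using pos[of "Suc n"] by (simp add: sum_divide_distrib[symmetric] mult_ac)
      also have "\<dots> \<le> (l + 1) * \<phi> (Suc n)"
        using elim pos[of "Suc n"] by (intro mult_right_mono) auto
      finally show "(\<Sum>j<m. \<Sum>q\<in>UNIV. \<bar>u p q (n - j) * x q j\<bar>) \<le> (l + 1) * \<phi> (Suc n)" .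
    qed
  qed
  moreover have "l + 1 \<ge> 0" unfolding l_def using C(1) r
    by (intro add_nonneg_nonneg sum_nonneg) auto
  ultimately show ?thesis using that by blast
qed

lemma rec_split:
  assumes "2 * m \<le> n"
  shows "x p (Suc n) = (\<Sum>k<m. \<Sum>q\<in>UNIV. u p q k * x q (n - k))
           + (\<Sum>k=m..n-m. \<Sum>q\<in>UNIV. u p q k * x q (n - k))
           + (\<Sum>j<m. \<Sum>q\<in>UNIV. u p q (n - j) * x q j)"
proof -
  have "(\<Sum>j<m. \<Sum>q\<in>UNIV. u p q (n - j) * x q (n - (n - j)))
      = (\<Sum>j<m. \<Sum>q\<in>UNIV. u p q (n - j) * x q j)"
    using assms by (intro sum.cong) auto
  then show ?thesis unfolding rec sum_split_ends[OF assms] by simp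
qed

lemma abs_convolution_le:
  assumes "\<And>q k. k \<in> A \<Longrightarrow> \<bar>x q (n - k)\<bar> \<le> B * \<phi> (n - k)"
  shows "\<bar>\<Sum>k\<in>A. \<Sum>q\<in>UNIV. u p q k * x q (n - k)\<bar>
           \<le> B * (\<Sum>k\<in>A. \<Sum>q\<in>UNIV. \<bar>u p q k\<bar> * \<phi> (n - k))"
proof -
  have "\<bar>\<Sum>k\<in>A. \<Sum>q\<in>UNIV. u p q k * x q (n - k)\<bar>
      \<le> (\<Sum>k\<in>A. \<Sum>q\<in>UNIV. \<bar>u p q k * x q (n - k)\<bar>)"
    by (rule order_trans[OF sum_abs sum_mono]) (rule sum_abs)
  also have "\<dots> \<le> (\<Sum>k\<in>A. \<Sum>q\<in>UNIV. \<bar>u p q k\<bar> * (B * \<phi> (n - k)))"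
    unfolding abs_mult using assms by (intro sum_mono mult_left_mono) auto
  also have "\<dots> = B * (\<Sum>k\<in>A. \<Sum>q\<in>UNIV. \<bar>u p q k\<bar> * \<phi> (n - k))"
    by (simp add: sum_distrib_left mult_ac)
  finally show ?thesis .
qed

text \<open>
  If \<open>\<bar>x\<bar> \<le> B * \<phi>\<close> holds up to time \<open>n\<close>, the near and middle parts give at most \<open>(\<rho> + 2 * \<epsilon>) * B\<close> and the
  edge part at most a constant \<open>K\<close> that does not depend on \<open>B\<close>. Since \<open>\<rho> + 2 * \<epsilon> < 1\<close>, the bound
  reproduces itself at time \<open>n + 1\<close> as soon as \<open>B\<close> is large compared with \<open>K\<close>.
\<close>

lemma x_bounded:
  obtains B where "B \<ge> 0" "\<And>p n. \<bar>x p n\<bar> \<le> B * \<phi> n"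
proof -
  define \<epsilon> where "\<epsilon> = (1 - \<rho>) / 4"
  have \<epsilon>: "\<epsilon> > 0" unfolding \<epsilon>_def using \<rho> by simp
  obtain m where mid: "\<forall>\<^sub>F n in sequentially. \<forall>p.
      (\<Sum>k=m..n-m. \<Sum>q\<in>UNIV. \<bar>u p q k\<bar> * \<phi> (n - k)) \<le> \<epsilon> * \<phi> (Suc n)"
    using middle_small[OF \<epsilon>] by blast
  obtain K where K: "K \<ge> 0" and edge: "\<forall>\<^sub>F n in sequentially. \<forall>p.
      (\<Sum>j<m. \<Sum>q\<in>UNIV. \<bar>u p q (n - j) * x q j\<bar>) \<le> K * \<phi> (Suc n)"
    by (rule edge_bounded)
  have "\<forall>\<^sub>F n in sequentially. 2 * m \<le> n" by (rule eventually_ge_at_top)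
  with mid edge near_mass[OF \<epsilon>, of m]
  have "\<forall>\<^sub>F n in sequentially. \<forall>B\<ge>0. (\<forall>q. \<forall>j\<le>n. \<bar>x q j\<bar> \<le> B * \<phi> j) \<longrightarrow>
          (\<forall>p. \<bar>x p (Suc n)\<bar> \<le> ((\<rho> + 2 * \<epsilon>) * B + K) * \<phi> (Suc n))"
  proof eventually_elim
    case (elim n)
    show ?case
    proof (intro allI impI)
      fix B :: real and p
      assume B: "B \<ge> 0" and le: "\<forall>q. \<forall>j\<le>n. \<bar>x q j\<bar> \<le> B * \<phi> j"
      have "\<bar>\<Sum>k<m. \<Sum>q\<in>UNIV. u p q k * x q (n - k)\<bar>
          \<le> B * (\<Sum>k<m. \<Sum>q\<in>UNIV. \<bar>u p q k\<bar> * \<phi> (n - k))"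
        using le by (intro abs_convolution_le) auto
      also have "\<dots> \<le> B * ((\<rho> + \<epsilon>) * \<phi> (Suc n))"
        using elim(3) B by (intro mult_left_mono) auto
      finally have 1: "\<bar>\<Sum>k<m. \<Sum>q\<in>UNIV. u p q k * x q (n - k)\<bar> \<le> B * ((\<rho> + \<epsilon>) * \<phi> (Suc n))" .
      have "\<bar>\<Sum>k=m..n-m. \<Sum>q\<in>UNIV. u p q k * x q (n - k)\<bar>
          \<le> B * (\<Sum>k=m..n-m. \<Sum>q\<in>UNIV. \<bar>u p q k\<bar> * \<phi> (n - k))"
        using le by (intro abs_convolution_le) auto
      also have "\<dots> \<le> B * (\<epsilon> * \<phi> (Suc n))"
        using elim(1) B by (intro mult_left_mono) auto
      finally have 2: "\<bar>\<Sum>k=m..n-m. \<Sum>q\<in>UNIV. u p q k * x q (n - k)\<bar> \<le> B * (\<epsilon> * \<phi> (Suc n))" .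
      have "\<bar>\<Sum>j<m. \<Sum>q\<in>UNIV. u p q (n - j) * x q j\<bar>
          \<le> (\<Sum>j<m. \<Sum>q\<in>UNIV. \<bar>u p q (n - j) * x q j\<bar>)"
        by (rule order_trans[OF sum_abs sum_mono]) (rule sum_abs)
      also have "\<dots> \<le> K * \<phi> (Suc n)" using elim(2) by blast
      finally have 3: "\<bar>\<Sum>j<m. \<Sum>q\<in>UNIV. u p q (n - j) * x q j\<bar> \<le> K * \<phi> (Suc n)" .
      have "\<bar>x p (Suc n)\<bar> \<le> B * ((\<rho> + \<epsilon>) * \<phi> (Suc n)) + B * (\<epsilon> * \<phi> (Suc n)) + K * \<phi> (Suc n)"
        unfolding rec_split[OF elim(4)] using 1 2 3 by linarith
      also have "\<dots> = ((\<rho> + 2 * \<epsilon>) * B + K) * \<phi> (Suc n)" by (simp add: algebra_simps)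
      finally show "\<bar>x p (Suc n)\<bar> \<le> ((\<rho> + 2 * \<epsilon>) * B + K) * \<phi> (Suc n)" .
    qed
  qed
  then obtain n0 where step: "\<And>n B p. n \<ge> n0 \<Longrightarrow> B \<ge> 0 \<Longrightarrow> (\<forall>q. \<forall>j\<le>n. \<bar>x q j\<bar> \<le> B * \<phi> j) \<Longrightarrow>
      \<bar>x p (Suc n)\<bar> \<le> ((\<rho> + 2 * \<epsilon>) * B + K) * \<phi> (Suc n)"
    unfolding eventually_sequentially by blast
  \<comment> \<open>\<open>S\<close> takes care of the initial segment; \<open>K / (2 * \<epsilon>)\<close> is the fixed point of
      \<open>B \<mapsto> (\<rho> + 2 * \<epsilon>) * B + K\<close>, because \<open>1 - \<rho> - 2 * \<epsilon> = 2 * \<epsilon>\<close>.\<close>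
  define S where "S = (\<Sum>j\<le>n0. \<Sum>q\<in>UNIV. \<bar>x q j\<bar> / \<phi> j)"
  define B where "B = S + K / (2 * \<epsilon>)"
  have quot: "\<bar>x q j\<bar> / \<phi> j \<ge> 0" for q j using pos[of j] by simp
  have S0: "S \<ge> 0" unfolding S_def using quot by (intro sum_nonneg) auto
  have B: "B \<ge> 0" unfolding B_def using S0 K \<epsilon> by simp
  have "(\<rho> + 2 * \<epsilon>) * B + K \<le> B"
  proof -
    have "K = 2 * \<epsilon> * (K / (2 * \<epsilon>))" using \<epsilon> by simp
    also have "\<dots> \<le> 2 * \<epsilon> * B" unfolding B_def using S0 \<epsilon> by (intro mult_left_mono) auto
    also have "\<dots> = (1 - \<rho> - 2 * \<epsilon>) * B" unfolding \<epsilon>_def by (simp add: field_simps)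
    finally show ?thesis by (simp add: algebra_simps)
  qed
  then have contract: "((\<rho> + 2 * \<epsilon>) * B + K) * \<phi> n \<le> B * \<phi> n" for n
    using pos[of n] by (intro mult_right_mono) auto
  have init: "\<bar>x q j\<bar> \<le> B * \<phi> j" if "j \<le> n0" for q j
  proof -
    have "\<bar>x q j\<bar> / \<phi> j \<le> (\<Sum>q\<in>UNIV. \<bar>x q j\<bar> / \<phi> j)"
      using quot by (intro member_le_sum[of q UNIV "\<lambda>q. \<bar>x q j\<bar> / \<phi> j"]) auto
    also have "\<dots> \<le> S" unfolding S_def using that quot
      by (intro member_le_sum[of j "{..n0}" "\<lambda>j. \<Sum>q\<in>UNIV. \<bar>x q j\<bar> / \<phi> j"] sum_nonneg) auto
    also have "\<dots> \<le> B" unfolding B_def using K \<epsilon> by simp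
    finally show ?thesis using pos[of j] by (simp add: pos_divide_le_eq)
  qed
  have "\<forall>q. \<forall>j\<le>n. \<bar>x q j\<bar> \<le> B * \<phi> j" for n
  proof (induction n)
    case 0
    then show ?case using init by simp
  next
    case (Suc n)
    have "\<bar>x q (Suc n)\<bar> \<le> B * \<phi> (Suc n)" for q
    proof (cases "n \<ge> n0")
      case True
      show ?thesis using order_trans[OF step[OF True B Suc.IH] contract] .
    next
      case False
      then show ?thesis by (intro init) simp
    qed
    then show ?case using Suc.IH by (auto simp: le_Suc_eq)
  qed
  then show ?thesis using B that by blast
qed

text \<open>
  In the near and edge parts each weight ratio is replaced by its limit, with an error tending to
  zero because it is multiplied by a bounded quotient. What remains of the edge part oscillates
  arbitrarily little because the kernel does; the middle part is small uniformly; and what remains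
  of the near part is a combination of shifts of \<open>x / \<phi>\<close> with total coefficient at most \<open>\<rho>\<close>.
\<close>

lemma osc_step:
  assumes osc: "\<And>q. residue_osc_le N (\<lambda>n. x q n / \<phi> n) L" and "\<epsilon> > 0"
  shows "residue_osc_le N (\<lambda>n. x p n / \<phi> n) (\<rho> * L + \<epsilon>)"
proof -
  obtain B where B: "B \<ge> 0" "\<And>p n. \<bar>x p n\<bar> \<le> B * \<phi> n" by (rule x_bounded) blast
  have L: "L \<ge> 0" using osc unfolding residue_osc_le_def by force
  define \<delta> where "\<delta> = \<epsilon> / (4 * (B + 1))"
  have \<delta>: "\<delta> > 0" unfolding \<delta>_def using assms(2) B(1) by simp
  obtain m where mid: "\<forall>\<^sub>F n in sequentially. \<forall>p.
      (\<Sum>k=m..n-m. \<Sum>q\<in>UNIV. \<bar>u p q k\<bar> * \<phi> (n - k)) \<le> \<delta> * \<phi> (Suc n)"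
    using middle_small[OF \<delta>] by blast
  define w where "w = (\<lambda>q n. x q n / \<phi> n)"
  define c where "c = (\<lambda>k. (1 / r) ^ Suc k)"
  define e where "e = (\<lambda>k n. \<phi> (n - k) / \<phi> (Suc n) - c k)"
  have e: "e k \<longlonglongrightarrow> 0" for k
    unfolding e_def c_def using shifted_ratio[of k] by (simp add: LIM_zero_iff)
  have c: "c k > 0" for k unfolding c_def using r by simp
  have w: "\<bar>w q n\<bar> \<le> B" for q n
    unfolding w_def using B(2)[of q n] pos[of n] by (simp add: pos_divide_le_eq)
  have wphi: "x q n = w q n * \<phi> n" for q n
    unfolding w_def using pos[of n] by simp
  have frac: "\<phi> (n - k) / \<phi> (Suc n) = c k + e k n" for n k unfolding e_def by simp
  define near where "near = (\<lambda>n. \<Sum>k<m. \<Sum>q\<in>UNIV. u p q k * c k * w q (n - k))"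
  define nearerr where "nearerr = (\<lambda>n. \<Sum>k<m. \<Sum>q\<in>UNIV. u p q k * (e k n * w q (n - k)))"
  define midl where "midl = (\<lambda>n. (\<Sum>k=m..n-m. \<Sum>q\<in>UNIV. u p q k * x q (n - k)) / \<phi> (Suc n))"
  define edge where "edge = (\<lambda>n. \<Sum>j<m. \<Sum>q\<in>UNIV. c j * x q j * (u p q (n - j) / \<phi> (n - j)))"
  define edgeerr where
    "edgeerr = (\<lambda>n. \<Sum>j<m. \<Sum>q\<in>UNIV. x q j * (e j n * (u p q (n - j) / \<phi> (n - j))))"
  have "residue_osc_le N near (\<rho> * L)"
  proof (rule residue_osc_le_mono)
    show "residue_osc_le N near (\<Sum>k<m. \<Sum>q\<in>UNIV. \<bar>u p q k * c k\<bar> * L)"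
      unfolding near_def
    proof (intro residue_osc_le_sum residue_osc_le_cmult)
      fix q k
      show "residue_osc_le N (\<lambda>n. w q (n - k)) L"
        using residue_osc_le_shift[OF osc] unfolding w_def .
    qed auto
    have "(\<Sum>k<m. \<Sum>q\<in>UNIV. \<bar>u p q k * c k\<bar> * L)
        = (\<Sum>k<m. \<Sum>q\<in>UNIV. \<bar>u p q k\<bar> * (1 / r) ^ Suc k) * L"
      using c r by (simp add: sum_distrib_right abs_mult abs_of_pos c_def)
    also have "\<dots> \<le> \<rho> * L" using mass[of p m] L by (intro mult_right_mono)
    finally show "(\<Sum>k<m. \<Sum>q\<in>UNIV. \<bar>u p q k * c k\<bar> * L) \<le> \<rho> * L" .
  qed
  moreover have "residue_osc_le N nearerr (\<epsilon> / 8)"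
  proof (rule residue_osc_le_null)
    have "(\<lambda>n. e k n * w q (n - k)) \<longlonglongrightarrow> 0" for k q
    proof (rule lim_null_mult_right_bounded[OF e])
      show "\<forall>\<^sub>F n in sequentially. norm (w q (n - k)) \<le> B" using w by simp
    qed
    then have "nearerr \<longlonglongrightarrow> (\<Sum>k<m. \<Sum>q\<in>UNIV. u p q k * 0)"
      unfolding nearerr_def by (intro tendsto_intros)
    then show "nearerr \<longlonglongrightarrow> 0" by simp
  qed (use assms in simp)
  moreover have "residue_osc_le N midl (\<epsilon> / 2)"
  proof -
    have "\<forall>\<^sub>F n in sequentially. \<bar>midl n\<bar> \<le> \<epsilon> / 4"
      using mid
    proof eventually_elim
      case (elim n)
      have "\<bar>\<Sum>k=m..n-m. \<Sum>q\<in>UNIV. u p q k * x q (n - k)\<bar>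
          \<le> B * (\<Sum>k=m..n-m. \<Sum>q\<in>UNIV. \<bar>u p q k\<bar> * \<phi> (n - k))"
        using B by (intro abs_convolution_le) auto
      also have "\<dots> \<le> B * (\<delta> * \<phi> (Suc n))"
        using elim B by (intro mult_left_mono) auto
      also have "\<dots> \<le> (B + 1) * (\<delta> * \<phi> (Suc n))"
        using \<delta> pos[of "Suc n"] by (intro mult_right_mono) auto
      also have "\<dots> = \<epsilon> / 4 * \<phi> (Suc n)"
        unfolding \<delta>_def using B(1) by (simp add: field_simps)
      finally show ?case
        unfolding midl_def using pos[of "Suc n"] by (simp add: pos_divide_le_eq)
    qed
    from residue_osc_le_small[OF this] show ?thesis by simp
  qed
  moreover have "residue_osc_le N edge (\<epsilon> / 8)"
  proof (rule residue_osc_le_mono)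
    \<comment> \<open>The summand 1 keeps the denominator positive when all coefficients vanish.\<close>
    define \<eta> where "\<eta> = (\<epsilon> / 8) / (1 + (\<Sum>j<m. \<Sum>q\<in>UNIV. \<bar>c j * x q j\<bar>))"
    have den: "1 + (\<Sum>j<m. \<Sum>q\<in>UNIV. \<bar>c j * x q j\<bar>) > 0"
      by (intro add_pos_nonneg sum_nonneg) auto
    have \<eta>: "\<eta> > 0" unfolding \<eta>_def using assms(2) den by simp
    show "residue_osc_le N edge (\<Sum>j<m. \<Sum>q\<in>UNIV. \<bar>c j * x q j\<bar> * \<eta>)"
      unfolding edge_def
    proof (intro residue_osc_le_sum residue_osc_le_cmult)
      fix j q
      show "residue_osc_le N (\<lambda>n. u p q (n - j) / \<phi> (n - j)) \<eta>"
        by (rule residue_osc_le_shift[OF u_osc[OF \<eta>]])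
    qed auto
    have "(\<Sum>j<m. \<Sum>q\<in>UNIV. \<bar>c j * x q j\<bar> * \<eta>)
        \<le> (1 + (\<Sum>j<m. \<Sum>q\<in>UNIV. \<bar>c j * x q j\<bar>)) * \<eta>"
      using \<eta> by (simp add: sum_distrib_right distrib_right)
    also have "\<dots> = \<epsilon> / 8" unfolding \<eta>_def
      using nonzero_mult_div_cancel_left[OF less_imp_neq[OF den, symmetric], of "\<epsilon> / 8"]
      by (simp only: times_divide_eq_right)
    finally show "(\<Sum>j<m. \<Sum>q\<in>UNIV. \<bar>c j * x q j\<bar> * \<eta>) \<le> \<epsilon> / 8" .
  qed
  moreover have "residue_osc_le N edgeerr (\<epsilon> / 8)"
  proof (rule residue_osc_le_null)
    obtain C where C: "\<And>p q n. \<bar>u p q n\<bar> \<le> C * \<phi> n"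
      by (rule u_bounded) blast
    have "(\<lambda>n. e j n * (u p q (n - j) / \<phi> (n - j))) \<longlonglongrightarrow> 0" for j q
    proof (rule lim_null_mult_right_bounded[OF e])
      have "norm (u p q n / \<phi> n) \<le> C" for n
        using C[of p q n] pos[of n] by (simp add: pos_divide_le_eq)
      then show "\<forall>\<^sub>F n in sequentially. norm (u p q (n - j) / \<phi> (n - j)) \<le> C" by simp
    qed
    then have "edgeerr \<longlonglongrightarrow> (\<Sum>j<m. \<Sum>q\<in>UNIV. x q j * 0)"
      unfolding edgeerr_def by (intro tendsto_intros)
    then show "edgeerr \<longlonglongrightarrow> 0" by simp
  qed (use assms in simp)
  ultimately have "residue_osc_le N (\<lambda>n. near n + nearerr n + midl n + edge n + edgeerr n)
      (\<rho> * L + \<epsilon> / 8 + \<epsilon> / 2 + \<epsilon> / 8 + \<epsilon> / 8)"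
    by (intro residue_osc_le_add)
  then have total: "residue_osc_le N (\<lambda>n. near n + nearerr n + midl n + edge n + edgeerr n)
      (\<rho> * L + \<epsilon>)"
    by (rule residue_osc_le_mono) (use assms(2) in simp)
  have "\<forall>\<^sub>F n in sequentially. 2 * m \<le> n" by (rule eventually_ge_at_top)
  then have "\<forall>\<^sub>F n in sequentially.
      near n + nearerr n + midl n + edge n + edgeerr n = x p (Suc n) / \<phi> (Suc n)"
  proof eventually_elim
    case (elim n)
    have "(\<Sum>k<m. \<Sum>q\<in>UNIV. u p q k * x q (n - k)) / \<phi> (Suc n)
        = (\<Sum>k<m. \<Sum>q\<in>UNIV. u p q k * w q (n - k) * (\<phi> (n - k) / \<phi> (Suc n)))"
      by (simp add: sum_divide_distrib wphi mult_ac)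
    also have "\<dots> = near n + nearerr n"
      unfolding near_def nearerr_def frac by (simp add: sum.distrib[symmetric] algebra_simps)
    finally have 1: "(\<Sum>k<m. \<Sum>q\<in>UNIV. u p q k * x q (n - k)) / \<phi> (Suc n) = near n + nearerr n" .
    have "(\<Sum>j<m. \<Sum>q\<in>UNIV. u p q (n - j) * x q j) / \<phi> (Suc n)
        = (\<Sum>j<m. \<Sum>q\<in>UNIV. x q j * (u p q (n - j) / \<phi> (n - j)) * (\<phi> (n - j) / \<phi> (Suc n)))"
      using pos by (simp add: sum_divide_distrib mult_ac less_imp_neq[symmetric])
    also have "\<dots> = edge n + edgeerr n"
      unfolding edge_def edgeerr_def frac by (simp add: sum.distrib[symmetric] algebra_simps add_divide_distrib)
    finally have 2: "(\<Sum>j<m. \<Sum>q\<in>UNIV. u p q (n - j) * x q j) / \<phi> (Suc n) = edge n + edgeerr n" .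
    show ?case
      unfolding rec_split[OF elim] add_divide_distrib 1 2 midl_def by simp
  qed
  from residue_osc_le_cong[OF this] total
  have "residue_osc_le N (\<lambda>n. x p (Suc n) / \<phi> (Suc n)) (\<rho> * L + \<epsilon>)" by blast
  then show ?thesis by (simp add: residue_osc_le_Suc_iff[of N "\<lambda>n. x p n / \<phi> n"])
qed

text \<open>
  Taking \<open>\<epsilon> = (1 - \<rho>) / 2 * L\<close> in the previous step multiplies a positive bound \<open>L\<close> by
  \<open>\<theta> = (1 + \<rho>) / 2 < 1\<close>, so the iterated bounds tend to zero.
\<close>

theorem solution_osc:
  assumes "\<epsilon> > 0"
  shows "residue_osc_le N (\<lambda>n. x p n / \<phi> n) \<epsilon>"
proof -
  obtain B where B: "B \<ge> 0" "\<And>p n. \<bar>x p n\<bar> \<le> B * \<phi> n" by (rule x_bounded) blast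
  define \<theta> where "\<theta> = (1 + \<rho>) / 2"
  have \<theta>: "0 < \<theta>" "\<theta> < 1" unfolding \<theta>_def using \<rho> rho_nonneg by auto
  have "residue_osc_le N (\<lambda>n. x p n / \<phi> n) (\<theta> ^ s * (2 * (B + 1)))" for s p
  proof (induction s arbitrary: p)
    case 0
    have "\<bar>x p n / \<phi> n\<bar> \<le> B + 1" for n
      using B(2)[of p n] pos[of n] by (simp add: pos_divide_le_eq distrib_right)
    then have "residue_osc_le N (\<lambda>n. x p n / \<phi> n) (2 * (B + 1))"
      by (intro residue_osc_le_small) simp
    then show ?case by simp
  next
    case (Suc s)
    define L where "L = \<theta> ^ s * (2 * (B + 1))"
    have "L > 0" unfolding L_def using \<theta> B(1) by simp
    then have "residue_osc_le N (\<lambda>n. x p n / \<phi> n) (\<rho> * L + (1 - \<rho>) / 2 * L)"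
      using Suc.IH \<rho> unfolding L_def[symmetric] by (intro osc_step) auto
    moreover have "\<rho> * L + (1 - \<rho>) / 2 * L = \<theta> * L" unfolding \<theta>_def by (simp add: field_simps)
    ultimately show ?case unfolding L_def by (simp add: mult.assoc)
  qed
  moreover have "(\<lambda>s. \<theta> ^ s * (2 * (B + 1))) \<longlonglongrightarrow> 0"
    using \<theta> by (intro tendsto_mult_left_zero LIMSEQ_realpow_zero) auto
  then have "\<forall>\<^sub>F s in sequentially. \<theta> ^ s * (2 * (B + 1)) < \<epsilon>"
    using assms by (rule order_tendstoD(2))
  then obtain s where "\<theta> ^ s * (2 * (B + 1)) < \<epsilon>"
    using eventually_happens trivial_limit_sequentially by blast
  ultimately show ?thesis by (meson residue_osc_le_mono less_imp_le)
qed

end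

section \<open>Weight classes and matrix sequences\<close>

lemma weight_class_ratio:
  assumes "\<phi> \<in> weight_class r"
  shows "(\<lambda>n. \<phi> n / \<phi> (Suc n)) \<longlonglongrightarrow> 1 / r"
  using assms LIMSEQ_Suc[of "\<lambda>n. \<phi> (n - 1) / \<phi> n" "1 / r"] unfolding weight_class_def by simp

lemma weight_class_middle:
  assumes "\<phi> \<in> weight_class r" "\<epsilon> > 0"
  shows "\<exists>M. \<forall>m\<ge>M. \<forall>\<^sub>F n in sequentially. (\<Sum>i=m..n-m. \<phi> (n - i) * \<phi> i) \<le> \<epsilon> * \<phi> n"
proof -
  have pos: "\<And>n. \<phi> n > 0" and
    lim: "(\<lambda>m. limsup (\<lambda>n. ereal (1 / \<phi> n * (\<Sum>i=m..n-m. \<phi> (n - i) * \<phi> i)))) \<longlonglongrightarrow> 0"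
    using assms(1) unfolding weight_class_def by auto
  have "\<forall>\<^sub>F m in sequentially.
      limsup (\<lambda>n. ereal (1 / \<phi> n * (\<Sum>i=m..n-m. \<phi> (n - i) * \<phi> i))) < ereal \<epsilon>"
    using assms(2) by (intro order_tendstoD(2)[OF lim]) simp
  then have "\<forall>\<^sub>F m in sequentially. \<forall>\<^sub>F n in sequentially.
      (\<Sum>i=m..n-m. \<phi> (n - i) * \<phi> i) \<le> \<epsilon> * \<phi> n"
  proof eventually_elim
    case (elim m)
    from Limsup_lessD[OF elim] show ?case
    proof eventually_elim
      case (elim n)
      then show ?case using pos[of n] by (simp add: pos_divide_less_eq)
    qed
  qed
  then show ?thesis unfolding eventually_sequentially .
qed

text \<open>
  The ratio \<open>\<phi> (N * n) / \<phi> (N * n + i)\<close> has the nonzero limit \<open>(1 / r) ^ i\<close>, so normalising a whole block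
  by the weight at its start or each term by its own weight makes no difference to convergence.
\<close>

lemma weight_class_residue_iff:
  assumes "\<phi> \<in> weight_class r" "N \<ge> 1"
  shows "(\<forall>i<N. convergent (\<lambda>n. f (N * n + i) / \<phi> (N * n)))
           \<longleftrightarrow> (\<forall>\<epsilon>>0. residue_osc_le N (\<lambda>n. f n / \<phi> n) \<epsilon>)"
proof -
  have pos: "\<And>n. \<phi> n > 0" and r: "r > 0"
    using assms(1) unfolding weight_class_def by auto
  have "convergent (\<lambda>n. f (N * n + i) / \<phi> (N * n))
      \<longleftrightarrow> convergent (\<lambda>n. f (N * n + i) / \<phi> (N * n + i))" for i
  proof -
    have "strict_mono (\<lambda>n. N * n)" using assms(2) by (intro strict_monoI) simp
    from LIMSEQ_subseq_LIMSEQ[OF ratio_tendsto_power[OF pos weight_class_ratio[OF assms(1)], of i] this]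
    have lim: "(\<lambda>n. \<phi> (N * n) / \<phi> (N * n + i)) \<longlonglongrightarrow> (1 / r) ^ i" by (simp add: o_def)
    have lim': "(\<lambda>n. inverse (\<phi> (N * n) / \<phi> (N * n + i))) \<longlonglongrightarrow> inverse ((1 / r) ^ i)"
      using r by (intro tendsto_inverse[OF lim]) simp
    have 1: "f (N * n + i) / \<phi> (N * n + i)
        = f (N * n + i) / \<phi> (N * n) * (\<phi> (N * n) / \<phi> (N * n + i))" for n
      using pos by (simp add: less_imp_neq[symmetric])
    have 2: "f (N * n + i) / \<phi> (N * n)
        = f (N * n + i) / \<phi> (N * n + i) * inverse (\<phi> (N * n) / \<phi> (N * n + i))" for n
      using pos by (simp add: less_imp_neq[symmetric])
    show ?thesis
    proof
      assume "convergent (\<lambda>n. f (N * n + i) / \<phi> (N * n))"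
      then show "convergent (\<lambda>n. f (N * n + i) / \<phi> (N * n + i))"
        unfolding 1 using lim by (intro convergent_mult) (auto simp: convergent_def)
    next
      assume "convergent (\<lambda>n. f (N * n + i) / \<phi> (N * n + i))"
      then show "convergent (\<lambda>n. f (N * n + i) / \<phi> (N * n))"
        unfolding 2 using lim' by (intro convergent_mult) (auto simp: convergent_def)
    qed
  qed
  then show ?thesis by (simp add: residue_osc_le_iff_convergent[OF assms(2)])
qed

lemma weight_function_iff:
  fixes U :: "nat \<Rightarrow> real ^ 'd ^ 'd"
  shows "weight_function r N \<phi> U \<longleftrightarrow> N \<ge> 1 \<and> \<phi> \<in> weight_class r \<and>
     (\<forall>p q. \<forall>\<epsilon>>0. residue_osc_le N (\<lambda>n. U n $ p $ q / \<phi> n) \<epsilon>)"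
proof (cases "N \<ge> 1 \<and> \<phi> \<in> weight_class r")
  case True
  have "(\<exists>A. \<forall>i<N. (\<lambda>n. (1 / \<phi> (N * n)) *\<^sub>R U (N * n + i)) \<longlonglongrightarrow> A i)
      \<longleftrightarrow> (\<forall>p q. \<forall>i<N. convergent (\<lambda>n. U (N * n + i) $ p $ q / \<phi> (N * n)))"
  proof
    assume "\<exists>A. \<forall>i<N. (\<lambda>n. (1 / \<phi> (N * n)) *\<^sub>R U (N * n + i)) \<longlonglongrightarrow> A i"
    then obtain A where A: "\<And>i. i < N \<Longrightarrow> (\<lambda>n. (1 / \<phi> (N * n)) *\<^sub>R U (N * n + i)) \<longlonglongrightarrow> A i"
      by blast
    have "(\<lambda>n. U (N * n + i) $ p $ q / \<phi> (N * n)) \<longlonglongrightarrow> A i $ p $ q" if "i < N" for i p q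
      using tendsto_vec_nth[OF tendsto_vec_nth[OF A[OF that]], of p q] by simp
    then show "\<forall>p q. \<forall>i<N. convergent (\<lambda>n. U (N * n + i) $ p $ q / \<phi> (N * n))"
      unfolding convergent_def by blast
  next
    assume conv: "\<forall>p q. \<forall>i<N. convergent (\<lambda>n. U (N * n + i) $ p $ q / \<phi> (N * n))"
    define A :: "nat \<Rightarrow> real ^ 'd ^ 'd" where
      "A = (\<lambda>i. \<chi> p q. lim (\<lambda>n. U (N * n + i) $ p $ q / \<phi> (N * n)))"
    have "(\<lambda>n. (1 / \<phi> (N * n)) *\<^sub>R U (N * n + i)) \<longlonglongrightarrow> A i" if "i < N" for i
    proof (intro vec_tendstoI)
      fix p q
      show "(\<lambda>n. ((1 / \<phi> (N * n)) *\<^sub>R U (N * n + i)) $ p $ q) \<longlonglongrightarrow> A i $ p $ q"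
        using conv that by (simp add: A_def convergent_LIMSEQ_iff)
    qed
    then show "\<exists>A. \<forall>i<N. (\<lambda>n. (1 / \<phi> (N * n)) *\<^sub>R U (N * n + i)) \<longlonglongrightarrow> A i" by blast
  qed
  then show ?thesis
    using True unfolding weight_function_def
    by (simp add: weight_class_residue_iff[of \<phi> r N "\<lambda>n. U n $ p $ q" for p q])
qed (auto simp: weight_function_def)

text \<open>
  Since \<open>1 / r \<ge> 1\<close> and \<open>N * l + i + 1 \<le> N * (l + 1)\<close>, each power of \<open>1 / r\<close> is at most the one at the
  end of its block. Summability ensures that the series on the right are true sums: the power at the
  end of a block exceeds that of any of its terms by a factor of at most \<open>(1 / r) ^ N\<close>.
\<close>

lemma partial_mass_le_block_mass:
  fixes a :: "nat \<Rightarrow> real"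
  assumes "N \<ge> 1" "0 < r" "r \<le> 1" "\<And>n. a n \<ge> 0"
    and summ: "summable (\<lambda>n. a n * (1 / r) ^ n)"
  shows "(\<Sum>k<m. a k * (1 / r) ^ Suc k)
           \<le> (\<Sum>i<N. \<Sum>l. r powi (- int (N * (l + 1))) * a (N * l + i))"
proof -
  have one: "1 / r \<ge> 1" using assms by simp
  have powi: "r powi (- int n) = (1 / r) ^ n" for n
    by (simp add: power_int_minus power_one_over inverse_eq_divide)
  have "(\<Sum>k<m. a k * (1 / r) ^ Suc k) \<le> (\<Sum>k<m * N. a k * (1 / r) ^ Suc k)"
    using assms by (intro sum_mono2) auto
  also have "\<dots> = (\<Sum>l<m. \<Sum>k=l*N..<l*N+N. a k * (1 / r) ^ Suc k)"
    by (rule sum.nat_group[symmetric])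
  also have "\<dots> = (\<Sum>l<m. \<Sum>i<N. a (N * l + i) * (1 / r) ^ Suc (N * l + i))"
  proof (rule sum.cong[OF refl])
    fix l
    show "(\<Sum>k=l*N..<l*N+N. a k * (1 / r) ^ Suc k)
        = (\<Sum>i<N. a (N * l + i) * (1 / r) ^ Suc (N * l + i))"
      by (rule sum.reindex_bij_witness[of _ "\<lambda>i. N * l + i" "\<lambda>k. k - N * l"])
        (auto simp: mult.commute)
  qed
  also have "\<dots> \<le> (\<Sum>l<m. \<Sum>i<N. a (N * l + i) * (1 / r) ^ (N * (l + 1)))"
    using assms(4) by (intro sum_mono mult_left_mono power_increasing one) auto
  also have "\<dots> = (\<Sum>i<N. \<Sum>l<m. r powi (- int (N * (l + 1))) * a (N * l + i))"
    unfolding powi by (subst sum.swap) (simp add: mult.commute)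
  also have "\<dots> \<le> (\<Sum>i<N. \<Sum>l. r powi (- int (N * (l + 1))) * a (N * l + i))"
  proof (rule sum_mono)
    fix i
    have "summable ((\<lambda>n. a n * (1 / r) ^ n) \<circ> (\<lambda>l. N * l + i))"
      using assms by (intro summable_reindex[OF summ]) (auto intro: injI)
    then have "summable (\<lambda>l. (1 / r) ^ N * (a (N * l + i) * (1 / r) ^ (N * l + i)))"
      by (intro summable_mult) (simp add: o_def)
    then have "summable (\<lambda>l. r powi (- int (N * (l + 1))) * a (N * l + i))"
    proof (rule summable_comparison_test'[where N = 0])
      fix l
      have "(1 / r) ^ (N * (l + 1)) \<le> (1 / r) ^ (N + (N * l + i))"
        by (intro power_increasing one) simp
      then have "(1 / r) ^ (N * (l + 1)) * a (N * l + i)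
          \<le> (1 / r) ^ (N + (N * l + i)) * a (N * l + i)"
        using assms(4) by (intro mult_right_mono)
      then show "norm (r powi (- int (N * (l + 1))) * a (N * l + i))
          \<le> (1 / r) ^ N * (a (N * l + i) * (1 / r) ^ (N * l + i))"
        unfolding powi using assms by (simp add: abs_mult power_add mult_ac)
    qed
    then show "(\<Sum>l<m. r powi (- int (N * (l + 1))) * a (N * l + i))
        \<le> (\<Sum>l. r powi (- int (N * (l + 1))) * a (N * l + i))"
      using assms by (intro sum_le_suminf) auto
  qed
  finally show ?thesis .
qed

theorem theorem3p2:
  fixes U Z :: "nat \<Rightarrow> real ^ 'd ^ 'd"
    and \<phi> :: "nat \<Rightarrow> real"
    and r :: real
    and N :: nat
  assumes "N \<ge> 1"
    and "0 < r" and "r \<le> 1"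
    and "Z 0 = mat 1"
    and "\<And>n. Z (n + 1) = (\<Sum>j=0..n. U (n - j) ** Z j)"
    and "weight_function r N \<phi> U"
    and "Max (range (\<lambda>p::'d. \<Sum>q\<in>UNIV. \<Sum>i<N. \<Sum>l. r powi (- int (N * (l + 1))) * \<bar>U (N * l + i) $ p $ q\<bar>)) < 1"
  shows "Z \<in> periodic_weight_class r N \<and>
    (\<exists>\<rho> :: nat \<Rightarrow> real ^ 'd ^ 'd. \<forall>i<N. (\<lambda>n. (1 / \<phi> (N * n)) *\<^sub>R Z (N * n + i)) \<longlonglongrightarrow> \<rho> i)"
proof -
  define rowmass where "rowmass = (\<lambda>p::'d. \<Sum>q\<in>UNIV. \<Sum>i<N. \<Sum>l.
      r powi (- int (N * (l + 1))) * \<bar>U (N * l + i) $ p $ q\<bar>)"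
  define \<rho> where "\<rho> = Max (range rowmass)"
  have \<rho>: "\<rho> < 1" using assms(7) unfolding \<rho>_def rowmass_def .
  have \<phi>: "\<phi> \<in> weight_class r" using assms(6) unfolding weight_function_def by blast
  have pos: "\<And>n. \<phi> n > 0" and "summable (\<lambda>i. \<phi> i * r powi (- int i))"
    using \<phi> unfolding weight_class_def by auto
  then have summ\<phi>: "summable (\<lambda>i. \<phi> i * (1 / r) ^ i)"
    by (simp add: power_int_minus power_one_over inverse_eq_divide)
  have osc: "residue_osc_le N (\<lambda>n. U n $ p $ q / \<phi> n) \<epsilon>" if "\<epsilon> > 0" for p q \<epsilon>
    using assms(6) that unfolding weight_function_iff by blast
  have summ: "summable (\<lambda>n. \<bar>U n $ p $ q\<bar> * (1 / r) ^ n)" for p q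
  proof -
    obtain C where C: "\<And>n. \<bar>U n $ p $ q / \<phi> n\<bar> \<le> C"
      using residue_osc_le_bounded[OF osc[of 1 p q] assms(1)] by (metis zero_less_one)
    show ?thesis
    proof (rule summable_comparison_test'[where N = 0])
      show "summable (\<lambda>n. C * (\<phi> n * (1 / r) ^ n))" by (intro summable_mult summ\<phi>)
      fix n
      have "\<bar>U n $ p $ q\<bar> \<le> C * \<phi> n" using C[of n] pos[of n] by (simp add: pos_divide_le_eq)
      then have "\<bar>U n $ p $ q\<bar> * (1 / r) ^ n \<le> (C * \<phi> n) * (1 / r) ^ n"
        using assms(2) by (intro mult_right_mono) auto
      then show "norm (\<bar>U n $ p $ q\<bar> * (1 / r) ^ n) \<le> C * (\<phi> n * (1 / r) ^ n)"
        using assms(2) by (simp add: abs_mult mult.assoc)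
    qed
  qed
  have mass: "(\<Sum>k<m. \<Sum>q\<in>UNIV. \<bar>U k $ p $ q\<bar> * (1 / r) ^ Suc k) \<le> \<rho>" for p m
  proof -
    have "(\<Sum>k<m. \<Sum>q\<in>UNIV. \<bar>U k $ p $ q\<bar> * (1 / r) ^ Suc k)
        = (\<Sum>q\<in>UNIV. \<Sum>k<m. \<bar>U k $ p $ q\<bar> * (1 / r) ^ Suc k)"
      by (rule sum.swap)
    also have "\<dots> \<le> rowmass p"
      unfolding rowmass_def using assms(1-3) summ
      by (intro sum_mono partial_mass_le_block_mass) auto
    also have "\<dots> \<le> \<rho>" unfolding \<rho>_def by (intro Max_ge) auto
    finally show ?thesis .
  qed
  \<comment> \<open>Reversing the sum puts the kernel index first, as the cut of the convolution requires.\<close>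
  have rec: "Z (Suc n) $ p $ c = (\<Sum>k\<le>n. \<Sum>q\<in>UNIV. U k $ p $ q * Z (n - k) $ q $ c)" for n p c
  proof -
    have "Z (Suc n) = (\<Sum>k\<le>n. U k ** Z (n - k))"
      using assms(5)[of n] unfolding atMost_atLeast0
      by (simp add: sum.atLeastAtMost_rev[of "\<lambda>k. U k ** Z (n - k)" 0 n])
    then show ?thesis by (simp add: sum_component matrix_matrix_mult_def)
  qed
  have "weighted_renewal \<phi> r \<rho> N (\<lambda>p q n. U n $ p $ q) (\<lambda>p n. Z n $ p $ c)" for c
    using assms(1,2) pos weight_class_ratio[OF \<phi>] weight_class_middle[OF \<phi>] osc mass \<rho> rec
    by unfold_locales auto
  then have "residue_osc_le N (\<lambda>n. Z n $ p $ c / \<phi> n) \<epsilon>" if "\<epsilon> > 0" for p c \<epsilon>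
    using weighted_renewal.solution_osc that by fastforce
  then have "weight_function r N \<phi> Z"
    unfolding weight_function_iff using assms(1) \<phi> by blast
  then show ?thesis
    unfolding periodic_weight_class_def by (auto simp: weight_function_def)
qed

end
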